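(* Let $n\ge1$, $w_0,\dots,w_n\ge1$ be integers, $\mu=w_0+\cdots+w_n$, and let $F^{sing}(\mathbf t)=\sum_{\boldsymbol\alpha}A(\boldsymbol\alpha)\frac{t^{\boldsymbol\alpha}}{\boldsymbol\alpha!}$ be the potential, in the flat coordinates $t_0,\dots,t_{\mu-1}$, of the canonical Frobenius structure on the base of a universal unfolding of $f=u_0+\cdots+u_n$ restricted to $U=\{\prod u_i^{w_i}=1\}$. Then $F^{sing}$ (up to terms of degree $\le 2$) is determined by the numbers $A_{1jk}(\mathbf 0)$ with $j,k\in\{0,\dots,\mu-1\}$ such that $1+j+k\equiv n \bmod \mu$. That is: the WDVV equations, the homogeneity condition, and the values $A_{1jk}(\mathbf 0)$ (which are $0$ when $1+j+k\not\equiv n\bmod\mu$) determine all coefficients $A(\boldsymbol\alpha)$ with $|\boldsymbol\alpha|\ge3$: if $F=\sum_{\boldsymbol\alpha}B(\boldsymbol\alpha)\frac{t^{\boldsymbol\alpha}}{\boldsymbol\alpha!}$ is any power series satisfying the same WDVV equations and homogeneity condition, with $B_{1jk}(\mathbf 0)=A_{1jk}(\mathbf 0)$ for all $j,k$, then $B(\boldsymbol\alpha)=A(\boldsymbol\alpha)$ for all $|\boldsymbol\alpha|\ge 3$.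
   Context: Notation: $\boldsymbol\alpha=(\alpha_0,\dots,\alpha_{\mu-1})\in\mathbb{N}^\mu$, $\frac{t^{\boldsymbol\alpha}}{\boldsymbol\alpha!}=\prod_i\frac{t_i^{\alpha_i}}{\alpha_i!}$, $|\boldsymbol\alpha|=\sum\alpha_i$; $A_{ijk}(\boldsymbol\alpha)=A(\boldsymbol\alpha+1_i+1_j+1_k)$ with $1_i$ the $i$-th unit vector (so $A_{ijk}(\mathbf 0)=\partial_i\partial_j\partial_kF^{sing}(0)$), and likewise $B_{ijk}$. Data: let $s(0)\le\cdots\le s(\mu-1)$ be the elements with multiplicity of $\bigsqcup_{i=0}^n\{\ell/w_i\mid0\le\ell\le w_i-1\}$ in nondecreasing order, $\sigma(k)=k-\mu s(k)$, $I(r)=\{i\mid rw_i\in\mathbb{Z}\}$; bars denote residues mod $\mu$ in $\{0,\dots,\mu-1\}$. The canonical Frobenius structure (Douai–Sabbah) of $f$ is the unique germ of semi-simple Frobenius manifold with, in the basis $e_i=\partial_{t_i}|_0$ of the tangent space at $0$: flat metric $g(e_j,e_k)=\prod_{i\in I(s(k))}w_i^{-1}$ if $\overline{j+k}=n$, and $0$ otherwise; unit $e_0$; Euler field $\mathfrak{E}=\sum_{k=0}^{\mu-1}(1-\sigma(k))t_k\partial_{t_k}+\mu\,\partial_{t_1}$; and multiplication by $\mathfrak E$ at $0$ given by $e_j\mapsto\mu\, c_j\,e_{\overline{j+1}}$, with $c_j=1$ if $s(\overline{j+1})=s(j)$ and $c_j=\prod_{i\in I(s(j))}w_i^{-1}$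 otherwise. Since $\mathfrak{E}|_0=\mu e_1$, one has $A_{1jk}(\mathbf 0)=g(e_1\star e_j,e_k)=c_j\,g(e_{\overline{j+1}},e_k)$. The potential satisfies the following conditions, where $F_{ijk}=\partial_{t_i}\partial_{t_j}\partial_{t_k}F$, $(g^{ab})$ is the inverse matrix of $g$ and $a^\star$ is the index with $\overline{a+a^\star}=n$: WDVV, for all $i,j,k,\ell$: $\sum_{a}F_{ija}\,g^{aa^\star}F_{a^\star k\ell}=\sum_aF_{jka}\,g^{aa^\star}F_{a^\star i\ell}$; homogeneity: $\mathfrak{E}\cdot F=(3-n)F$ up to terms of degree $\le2$ in $\mathbf t$. *)

theory Defs
  imports
    "HOL-Analysis.Infinite_Sum"
    "HOL-Library.Poly_Mapping"
    "Jordan_Normal_Form.Gauss_Jordan_Elimination"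
begin

section \<open>Power series in finitely many variables\<close>

text \<open>
  A series \<open>a\<close> stands for the sum of \<open>a \<alpha> * t^\<alpha>\<close>. In \<open>m\<close> variables \<open>t\<^sub>0, ..., t\<^sub>m\<^sub>-\<^sub>1\<close> only the
  exponents in \<open>multi_idx m\<close> matter, so identities between series are stated at those exponents;
  values of \<open>a\<close> elsewhere never influence them.
\<close>

type_synonym series = "(nat \<Rightarrow>\<^sub>0 nat) \<Rightarrow> complex"

abbreviation unit_idx :: "nat \<Rightarrow> (nat \<Rightarrow>\<^sub>0 nat)" where
  "unit_idx i \<equiv> Poly_Mapping.single i 1"

definition multi_idx :: "nat \<Rightarrow> (nat \<Rightarrow>\<^sub>0 nat) set" where
  "multi_idx m = {\<alpha>. Poly_Mapping.keys \<alpha> \<subseteq> {..<m}}"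

definition idx_deg :: "(nat \<Rightarrow>\<^sub>0 nat) \<Rightarrow> nat" where
  "idx_deg \<alpha> = (\<Sum>i\<in>Poly_Mapping.keys \<alpha>. Poly_Mapping.lookup \<alpha> i)"

definition idx_fact :: "(nat \<Rightarrow>\<^sub>0 nat) \<Rightarrow> nat" where
  "idx_fact \<alpha> = (\<Prod>i\<in>Poly_Mapping.keys \<alpha>. fact (Poly_Mapping.lookup \<alpha> i))"

definition exp_series :: "((nat \<Rightarrow>\<^sub>0 nat) \<Rightarrow> complex) \<Rightarrow> series" where
  "exp_series A = (\<lambda>\<alpha>. A \<alpha> / of_nat (idx_fact \<alpha>))"

definition coeff3 :: "((nat \<Rightarrow>\<^sub>0 nat) \<Rightarrow> complex) \<Rightarrow> nat \<Rightarrow> nat \<Rightarrow> nat \<Rightarrow> (nat \<Rightarrow>\<^sub>0 nat) \<Rightarrow> complex" where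
  "coeff3 A i j k = (\<lambda>\<alpha>. A (\<alpha> + unit_idx i + unit_idx j + unit_idx k))"

definition const_series :: "complex \<Rightarrow> series" where
  "const_series x = (\<lambda>\<alpha>. if \<alpha> = 0 then x else 0)"

definition var_series :: "nat \<Rightarrow> series" where
  "var_series k = (\<lambda>\<alpha>. if \<alpha> = unit_idx k then 1 else 0)"

text \<open>Cauchy product; the index set is finite for every \<open>\<alpha>\<close>.\<close>

definition times_series :: "series \<Rightarrow> series \<Rightarrow> series" where
  "times_series a b = (\<lambda>\<alpha>. \<Sum>(\<beta>, \<gamma>) \<in> {(\<beta>, \<gamma>). \<beta> + \<gamma> = \<alpha>}. a \<beta> * b \<gamma>)"

definition pd :: "nat \<Rightarrow> series \<Rightarrow> series" where
  "pd i a = (\<lambda>\<alpha>. of_nat (Poly_Mapping.lookup \<alpha> i + 1) * a (\<alpha> + unit_idx i))"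

definition pd3 :: "nat \<Rightarrow> nat \<Rightarrow> nat \<Rightarrow> series \<Rightarrow> series" where
  "pd3 i j k a = pd i (pd j (pd k a))"

text \<open>The derivation along the vector field with components \<open>E 0, ..., E (m - 1)\<close>.\<close>

definition vf_deriv :: "nat \<Rightarrow> (nat \<Rightarrow> series) \<Rightarrow> series \<Rightarrow> series" where
  "vf_deriv m E a = (\<lambda>\<alpha>. \<Sum>k<m. times_series (E k) (pd k a) \<alpha>)"

definition convergent_series :: "nat \<Rightarrow> series \<Rightarrow> bool" where
  "convergent_series m a \<longleftrightarrow>
     (\<exists>r::real>0. (\<lambda>\<alpha>. norm (a \<alpha>) * r ^ idx_deg \<alpha>) summable_on multi_idx m)"


section \<open>Germs of Frobenius manifolds in flat coordinates\<close>

text \<open>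
  A germ of Frobenius manifold at the origin of \<open>\<complex>\<^sup>m\<close>, in flat coordinates (so that the metric has
  constant Gram matrix \<open>g\<close> and covariant derivatives are partial derivatives). Here
  \<open>M i j k\<close> is the \<open>k\<close>-th component of the product of the \<open>i\<close>-th and \<open>j\<close>-th coordinate vector
  fields, \<open>u k\<close> and \<open>E k\<close> are the components of the unit and of the Euler field.
  The assumption \<open>codazzi\<close> says that the covariant derivative of the 3-tensor
  \<open>g(X \<star> Y, Z)\<close> is a symmetric 4-tensor.
  The assumptions \<open>euler_metric\<close> and \<open>euler_mult\<close> are the component forms of the Lie derivative
  conditions \<open>L\<^sub>E g = D g\<close> (for some constant \<open>D\<close>) and \<open>L\<^sub>E \<star> = \<star>\<close>.
\<close>

locale frobenius_germ =
  fixes m :: nat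
    and g :: "complex mat"
    and M :: "nat \<Rightarrow> nat \<Rightarrow> nat \<Rightarrow> series"
    and u :: "nat \<Rightarrow> series"
    and E :: "nat \<Rightarrow> series"
  assumes convergent_mult:
      "\<And>i j k. \<lbrakk>i < m; j < m; k < m\<rbrakk> \<Longrightarrow> convergent_series m (M i j k)"
    and convergent_unit: "\<And>k. k < m \<Longrightarrow> convergent_series m (u k)"
    and convergent_euler: "\<And>k. k < m \<Longrightarrow> convergent_series m (E k)"
    and metric_carrier: "g \<in> carrier_mat m m"
    and metric_sym: "transpose_mat g = g"
    and metric_nondegenerate: "invertible_mat g"
    and mult_comm:
      "\<And>i j k \<alpha>. \<lbrakk>i < m; j < m; k < m; \<alpha> \<in> multi_idx m\<rbrakk> \<Longrightarrow> M i j k \<alpha> = M j i k \<alpha>"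
    and mult_assoc:
      "\<And>i j k l \<alpha>. \<lbrakk>i < m; j < m; k < m; l < m; \<alpha> \<in> multi_idx m\<rbrakk> \<Longrightarrow>
         (\<Sum>a<m. times_series (M i j a) (M a k l) \<alpha>) = (\<Sum>a<m. times_series (M j k a) (M i a l) \<alpha>)"
    and mult_unit:
      "\<And>j k \<alpha>. \<lbrakk>j < m; k < m; \<alpha> \<in> multi_idx m\<rbrakk> \<Longrightarrow>
         (\<Sum>i<m. times_series (u i) (M i j k) \<alpha>) = const_series (if j = k then 1 else 0) \<alpha>"
    and mult_metric:
      "\<And>i j k \<alpha>. \<lbrakk>i < m; j < m; k < m; \<alpha> \<in> multi_idx m\<rbrakk> \<Longrightarrow>
         (\<Sum>a<m. M i j a \<alpha> * g $$ (a, k)) = (\<Sum>a<m. M j k a \<alpha> * g $$ (i, a))"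
    and unit_flat:
      "\<And>j k \<alpha>. \<lbrakk>j < m; k < m; \<alpha> \<in> multi_idx m\<rbrakk> \<Longrightarrow> pd j (u k) \<alpha> = 0"
    and codazzi:
      "\<And>i j k l \<alpha>. \<lbrakk>i < m; j < m; k < m; l < m; \<alpha> \<in> multi_idx m\<rbrakk> \<Longrightarrow>
         (\<Sum>a<m. pd l (M i j a) \<alpha> * g $$ (a, k)) = (\<Sum>a<m. pd i (M l j a) \<alpha> * g $$ (a, k))"
    and euler_metric:
      "\<exists>D::complex. \<forall>j<m. \<forall>k<m. \<forall>\<alpha>\<in>multi_idx m.
         (\<Sum>a<m. pd j (E a) \<alpha> * g $$ (a, k)) + (\<Sum>a<m. pd k (E a) \<alpha> * g $$ (j, a))
           = const_series (D * g $$ (j, k)) \<alpha>"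
    and euler_mult:
      "\<And>i j k \<alpha>. \<lbrakk>i < m; j < m; k < m; \<alpha> \<in> multi_idx m\<rbrakk> \<Longrightarrow>
         vf_deriv m E (M i j k) \<alpha>
           - (\<Sum>a<m. times_series (M i j a) (pd a (E k)) \<alpha>)
           + (\<Sum>a<m. times_series (pd i (E a)) (M a j k) \<alpha>)
           + (\<Sum>a<m. times_series (pd j (E a)) (M i a k) \<alpha>)
         = M i j k \<alpha>"

text \<open>
  Semi-simplicity of the germ: there is a frame of holomorphic vector fields \<open>P 0, ..., P (m - 1)\<close>
  (with components \<open>P a k\<close>) that are pairwise orthogonal idempotents.
\<close>

definition semisimple_mult :: "nat \<Rightarrow> (nat \<Rightarrow> nat \<Rightarrow> nat \<Rightarrow> series) \<Rightarrow> bool" where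
  "semisimple_mult m M \<longleftrightarrow> (\<exists>P :: nat \<Rightarrow> nat \<Rightarrow> series.
     (\<forall>a<m. \<forall>k<m. convergent_series m (P a k)) \<and>
     invertible_mat (mat m m (\<lambda>(a, k). P a k 0)) \<and>
     (\<forall>a<m. \<forall>b<m. \<forall>k<m. \<forall>\<alpha>\<in>multi_idx m.
        (\<Sum>i<m. \<Sum>j<m. times_series (times_series (P a i) (P b j)) (M i j k) \<alpha>)
          = (if a = b then P a k \<alpha> else 0)))"

definition is_potential ::
  "nat \<Rightarrow> complex mat \<Rightarrow> (nat \<Rightarrow> nat \<Rightarrow> nat \<Rightarrow> series) \<Rightarrow> series \<Rightarrow> bool" where
  "is_potential m g M F \<longleftrightarrow> (\<forall>i<m. \<forall>j<m. \<forall>k<m. \<forall>\<alpha>\<in>multi_idx m.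
     pd3 i j k F \<alpha> = (\<Sum>a<m. M i j a \<alpha> * g $$ (a, k)))"


section \<open>The canonical Frobenius structure\<close>

definition mu :: "nat \<Rightarrow> (nat \<Rightarrow> nat) \<Rightarrow> nat" where
  "mu n w = (\<Sum>i\<le>n. w i)"

definition spec :: "nat \<Rightarrow> (nat \<Rightarrow> nat) \<Rightarrow> nat \<Rightarrow> real" where
  "spec n w k =
     sort (concat (map (\<lambda>i. map (\<lambda>l. real l / real (w i)) [0..<w i]) [0..<Suc n])) ! k"

definition sigma :: "nat \<Rightarrow> (nat \<Rightarrow> nat) \<Rightarrow> nat \<Rightarrow> real" where
  "sigma n w k = real k - real (mu n w) * spec n w k"

definition idx_I :: "nat \<Rightarrow> (nat \<Rightarrow> nat) \<Rightarrow> real \<Rightarrow> nat set" where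
  "idx_I n w r = {i. i \<le> n \<and> r * real (w i) \<in> \<int>}"

definition metric :: "nat \<Rightarrow> (nat \<Rightarrow> nat) \<Rightarrow> complex mat" where
  "metric n w = mat (mu n w) (mu n w) (\<lambda>(j, k).
     if (j + k) mod mu n w = n
     then \<Prod>i\<in>idx_I n w (spec n w k). inverse (of_nat (w i)) else 0)"

definition inv_metric :: "nat \<Rightarrow> (nat \<Rightarrow> nat) \<Rightarrow> complex mat" where
  "inv_metric n w = the (mat_inverse (metric n w))"

text \<open>For \<open>a < mu n w\<close> this is the index \<open>b < mu n w\<close> with \<open>a + b\<close> congruent to \<open>n\<close>.\<close>

definition dual_idx :: "nat \<Rightarrow> (nat \<Rightarrow> nat) \<Rightarrow> nat \<Rightarrow> nat" where
  "dual_idx n w a = (n + (mu n w - a)) mod mu n w"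

definition unit_field :: "nat \<Rightarrow> series" where
  "unit_field k = const_series (if k = 0 then 1 else 0)"

definition euler_field :: "nat \<Rightarrow> (nat \<Rightarrow> nat) \<Rightarrow> nat \<Rightarrow> series" where
  "euler_field n w k = (\<lambda>\<alpha>. of_real (1 - sigma n w k) * var_series k \<alpha>
     + const_series (if k = 1 then of_nat (mu n w) else 0) \<alpha>)"

definition euler_coeff :: "nat \<Rightarrow> (nat \<Rightarrow> nat) \<Rightarrow> nat \<Rightarrow> complex" where
  "euler_coeff n w j = (if spec n w ((j + 1) mod mu n w) = spec n w j then 1
     else \<Prod>i\<in>idx_I n w (spec n w j). inverse (of_nat (w i)))"

definition canonical_frobenius ::
  "nat \<Rightarrow> (nat \<Rightarrow> nat) \<Rightarrow> (nat \<Rightarrow> nat \<Rightarrow> nat \<Rightarrow> series) \<Rightarrow> bool" where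
  "canonical_frobenius n w M \<longleftrightarrow>
     frobenius_germ (mu n w) (metric n w) M unit_field (euler_field n w) \<and>
     semisimple_mult (mu n w) M \<and>
     (\<forall>j<mu n w. \<forall>k<mu n w.
        (\<Sum>i<mu n w. euler_field n w i 0 * M i j k 0)
          = (if k = (j + 1) mod mu n w then of_nat (mu n w) * euler_coeff n w j else 0))"


section \<open>WDVV equations and homogeneity\<close>

definition WDVV :: "nat \<Rightarrow> (nat \<Rightarrow> nat) \<Rightarrow> series \<Rightarrow> bool" where
  "WDVV n w F \<longleftrightarrow> (\<forall>i<mu n w. \<forall>j<mu n w. \<forall>k<mu n w. \<forall>l<mu n w. \<forall>\<alpha>\<in>multi_idx (mu n w).
     (\<Sum>a<mu n w. inv_metric n w $$ (a, dual_idx n w a)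
        * times_series (pd3 i j a F) (pd3 (dual_idx n w a) k l F) \<alpha>)
     = (\<Sum>a<mu n w. inv_metric n w $$ (a, dual_idx n w a)
        * times_series (pd3 j k a F) (pd3 (dual_idx n w a) i l F) \<alpha>))"

definition homogeneous :: "nat \<Rightarrow> (nat \<Rightarrow> nat) \<Rightarrow> series \<Rightarrow> bool" where
  "homogeneous n w F \<longleftrightarrow> (\<forall>\<alpha>\<in>multi_idx (mu n w). 3 \<le> idx_deg \<alpha> \<longrightarrow>
     vf_deriv (mu n w) (euler_field n w) F \<alpha> = (3 - of_nat n) * F \<alpha>)"

end

theory Submission
  imports Defs
begin

text \<open>
  Let \<open>D\<close> be the difference of the third derivatives of two solutions at a fixed exponent \<open>\<beta>\<close>,
  and suppose that the solutions agree at all exponents of smaller degree. Since \<open>e\<^sub>1\<close> maps \<open>e\<^sub>j\<close> to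
  \<open>c\<^sub>j e\<^sub>j\<^sub>+\<^sub>1\<close> at the origin, WDVV with first index \<open>1\<close> becomes
  \<open>c\<^sub>j D j+1 k l = c\<^sub>l D j k l+1\<close> as soon as \<open>D 1 k l = 0\<close>; and iterating this relation brings
  the first index down to \<open>1\<close>, so that \<open>D\<close> vanishes. Finally \<open>D 1 k l = 0\<close> is the hypothesis for
  \<open>\<beta> = 0\<close>. For \<open>\<beta> \<noteq> 0\<close> it comes from homogeneity: because of the constant term of the Euler field,
  a coefficient of degree at least \<open>3\<close> determines the one with the exponent of \<open>t\<^sub>1\<close> raised by one.
\<close>

text \<open>Keeps the index \<open>1\<close> from being rewritten to \<open>Suc 0\<close>, so that
  rules about \<open>unit_idx 1\<close> and \<open>pd3 1 j k\<close> still match.\<close>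

declare One_nat_def [simp del]

section \<open>Multi-indices and series\<close>

lemma lookup_add_unit [simp]:
  "Poly_Mapping.lookup (\<alpha> + unit_idx i) k = Poly_Mapping.lookup \<alpha> k + (if i = k then 1 else 0)"
  by (simp add: lookup_add lookup_single when_def)

lemma unit_idx_nonzero [simp]: "unit_idx i \<noteq> 0"
  by (metis lookup_single_eq lookup_zero zero_neq_one)

lemma add_unit_idx_nonzero [simp]: "\<alpha> + unit_idx i \<noteq> 0"
proof
  assume "\<alpha> + unit_idx i = 0"
  then have "Poly_Mapping.lookup (\<alpha> + unit_idx i) i = 0" by simp
  then show False unfolding lookup_add_unit by simp
qed

lemma zero_in_multi_idx [simp]: "0 \<in> multi_idx m"
  by (simp add: multi_idx_def)

lemma unit_idx_in_multi_idx [simp]: "unit_idx i \<in> multi_idx m \<longleftrightarrow> i < m"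
  by (simp add: multi_idx_def)

lemma add_in_multi_idx [simp]:
  "\<alpha> + \<beta> \<in> multi_idx m \<longleftrightarrow> \<alpha> \<in> multi_idx m \<and> \<beta> \<in> multi_idx m"
proof -
  have "Poly_Mapping.keys (\<alpha> + \<beta>) = Poly_Mapping.keys \<alpha> \<union> Poly_Mapping.keys \<beta>"
    by (auto simp: in_keys_iff lookup_add)
  then show ?thesis by (auto simp: multi_idx_def)
qed

lemma idx_deg_eq:
  assumes "\<alpha> \<in> multi_idx m"
  shows "idx_deg \<alpha> = (\<Sum>i<m. Poly_Mapping.lookup \<alpha> i)"
  unfolding idx_deg_def
  by (rule sum.mono_neutral_left) (use assms in \<open>auto simp: multi_idx_def in_keys_iff\<close>)

lemma idx_deg_add:
  assumes "\<alpha> \<in> multi_idx m" "\<beta> \<in> multi_idx m"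
  shows "idx_deg (\<alpha> + \<beta>) = idx_deg \<alpha> + idx_deg \<beta>"
  using assms by (simp add: idx_deg_eq[of _ m] lookup_add sum.distrib)

lemma idx_deg_zero [simp]: "idx_deg 0 = 0"
  by (simp add: idx_deg_def)

lemma idx_deg_unit [simp]: "idx_deg (unit_idx i) = 1"
  by (simp add: idx_deg_def)

lemma idx_deg_pos:
  assumes "\<alpha> \<noteq> 0"
  shows "0 < idx_deg \<alpha>"
proof -
  obtain i where "i \<in> Poly_Mapping.keys \<alpha>" using assms by fastforce
  then have "\<exists>i\<in>Poly_Mapping.keys \<alpha>. 0 < Poly_Mapping.lookup \<alpha> i"
    by (metis gr0I in_keys_iff)
  then show ?thesis unfolding idx_deg_def by (simp add: sum_pos2 Bex_def) (metis finite_keys sum_pos2 zero_le)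
qed

lemma idx_remove_unit:
  assumes "0 < Poly_Mapping.lookup \<alpha> i"
  obtains \<beta> where "\<alpha> = \<beta> + unit_idx i"
proof
  show "\<alpha> = (\<alpha> - unit_idx i) + unit_idx i"
    using assms by (intro poly_mapping_eqI) (auto simp: lookup_minus lookup_single when_def)
qed

lemma idx_deg_SucE:
  assumes "\<alpha> \<in> multi_idx m" "idx_deg \<alpha> = Suc d"
  obtains \<beta> i where "\<alpha> = \<beta> + unit_idx i" "i < m" "\<beta> \<in> multi_idx m" "idx_deg \<beta> = d"
proof -
  have "\<alpha> \<noteq> 0" using assms by auto
  then obtain i where i: "i \<in> Poly_Mapping.keys \<alpha>" by fastforce
  then have "0 < Poly_Mapping.lookup \<alpha> i" by (simp add: in_keys_iff)
  then obtain \<beta> where \<beta>: "\<alpha> = \<beta> + unit_idx i" by (rule idx_remove_unit)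
  then have "\<beta> \<in> multi_idx m" "i < m" using assms by auto
  moreover have "idx_deg \<beta> = d"
    using assms(2) \<beta> calculation by (simp add: idx_deg_add[of _ m])
  ultimately show ?thesis using that \<beta> by blast
qed

text \<open>Peeling off three unit vectors makes every coefficient of degree at least 3 a
  coefficient of some third derivative; this carries statements about third derivatives back to the
  potential.\<close>

lemma idx_deg_ge_3E:
  assumes "\<alpha> \<in> multi_idx m" "3 \<le> idx_deg \<alpha>"
  obtains \<beta> i j k where "\<alpha> = \<beta> + unit_idx i + unit_idx j + unit_idx k"
    "i < m" "j < m" "k < m" "\<beta> \<in> multi_idx m" "idx_deg \<alpha> = idx_deg \<beta> + 3"
proof -
  obtain d where d: "idx_deg \<alpha> = Suc (Suc (Suc d))"
    using assms(2) add.commute[of 3] le_Suc_ex[of 3 "idx_deg \<alpha>"]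
    by (metis add_Suc_right add_0_right numeral_3_eq_3)
  obtain \<beta>\<^sub>1 k where 1: "\<alpha> = \<beta>\<^sub>1 + unit_idx k" "k < m" "\<beta>\<^sub>1 \<in> multi_idx m" "idx_deg \<beta>\<^sub>1 = Suc (Suc d)"
    using idx_deg_SucE[OF assms(1) d] .
  obtain \<beta>\<^sub>2 j where 2: "\<beta>\<^sub>1 = \<beta>\<^sub>2 + unit_idx j" "j < m" "\<beta>\<^sub>2 \<in> multi_idx m" "idx_deg \<beta>\<^sub>2 = Suc d"
    using idx_deg_SucE[OF 1(3,4)] .
  obtain \<beta> i where 3: "\<beta>\<^sub>2 = \<beta> + unit_idx i" "i < m" "\<beta> \<in> multi_idx m" "idx_deg \<beta> = d"
    using idx_deg_SucE[OF 2(3,4)] .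
  show ?thesis by (rule that[of \<beta> i j k]) (use 1 2 3 d in auto)
qed

section \<open>Cauchy products\<close>

text \<open>\<open>\<beta>\<close> is bounded pointwise by \<open>\<alpha>\<close> and determines
  \<open>\<gamma>\<close>. Finiteness matters because a sum over an infinite set is \<open>0\<close>
  by convention.\<close>

lemma finite_idx_splits: "finite {(\<beta>, \<gamma>). \<beta> + \<gamma> = (\<alpha> :: nat \<Rightarrow>\<^sub>0 nat)}"
proof -
  \<comment> \<open>The total degree is a crude bound that serves all entries at once, as one common
    finite codomain is required.\<close>
  let ?B = "{..(\<Sum>i\<in>Poly_Mapping.keys \<alpha>. Poly_Mapping.lookup \<alpha> i)}"
  let ?S = "{\<beta>. \<exists>\<gamma>. \<beta> + \<gamma> = \<alpha>}"
  have "Poly_Mapping.lookup ` ?S \<subseteq>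
      {f. \<forall>i. (i \<in> Poly_Mapping.keys \<alpha> \<longrightarrow> f i \<in> ?B) \<and> (i \<notin> Poly_Mapping.keys \<alpha> \<longrightarrow> f i = 0)}"
  proof (clarify, intro allI conjI impI, simp_all only: atMost_iff)
    fix \<beta> \<gamma> :: "nat \<Rightarrow>\<^sub>0 nat" and i
    have le: "Poly_Mapping.lookup \<beta> i \<le> Poly_Mapping.lookup (\<beta> + \<gamma>) i" by (simp add: lookup_add)
    show "Poly_Mapping.lookup \<beta> i \<le> sum (Poly_Mapping.lookup (\<beta> + \<gamma>)) (Poly_Mapping.keys (\<beta> + \<gamma>))"
      if "i \<in> Poly_Mapping.keys (\<beta> + \<gamma>)"
      using le member_le_sum[OF that, of "Poly_Mapping.lookup (\<beta> + \<gamma>)"] by simp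
    show "Poly_Mapping.lookup \<beta> i = 0" if "i \<notin> Poly_Mapping.keys (\<beta> + \<gamma>)"
      using le that by (simp add: in_keys_iff)
  qed
  then have "finite (Poly_Mapping.lookup ` ?S)"
    by (rule finite_subset) (rule finite_set_of_finite_funs, auto)
  then have "finite ?S" by (rule finite_imageD) (auto simp: inj_on_def poly_mapping_eqI)
  then have "finite ((\<lambda>\<beta>. (\<beta>, \<alpha> - \<beta>)) ` ?S)" by simp
  then show ?thesis by (rule rev_finite_subset) force
qed

text \<open>Evaluates products in which a single split contributes: those with constants or
  variables, and those at exponent \<open>0\<close>.\<close>

lemma times_series_single:
  assumes "\<beta> + \<gamma> = \<alpha>"
    and "\<And>\<beta>' \<gamma>'. \<beta>' + \<gamma>' = \<alpha> \<Longrightarrow> \<beta>' \<noteq> \<beta> \<Longrightarrow> a \<beta>' * b \<gamma>' = 0"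
  shows "times_series a b \<alpha> = a \<beta> * b \<gamma>"
proof -
  have "times_series a b \<alpha> = (\<Sum>(\<beta>, \<gamma>) \<in> {(\<beta>, \<gamma>)}. a \<beta> * b \<gamma>)"
    unfolding times_series_def
  proof (intro sum.mono_neutral_right finite_idx_splits ballI)
    show "{(\<beta>, \<gamma>)} \<subseteq> {(\<beta>, \<gamma>). \<beta> + \<gamma> = \<alpha>}" using assms(1) by simp
    fix p assume "p \<in> {(\<beta>, \<gamma>). \<beta> + \<gamma> = \<alpha>} - {(\<beta>, \<gamma>)}"
    then show "(case p of (\<beta>, \<gamma>) \<Rightarrow> a \<beta> * b \<gamma>) = 0"
      using assms by (cases p; cases "fst p = \<beta>") auto
  qed
  then show ?thesis by simp
qed

lemma times_series_const_left [simp]: "times_series (const_series x) a \<alpha> = x * a \<alpha>"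
  by (subst times_series_single[of 0 \<alpha>]) (auto simp: const_series_def)

lemma times_series_commute: "times_series a b = times_series b a"
  unfolding times_series_def
  by (rule ext, rule sum.reindex_bij_witness[of _ prod.swap prod.swap])
    (auto simp: add.commute mult.commute)

lemma times_series_const_right [simp]: "times_series a (const_series x) \<alpha> = a \<alpha> * x"
  by (subst times_series_commute) simp

text \<open>Both halves of a split of an exponent in \<open>multi_idx m\<close> lie in
  \<open>multi_idx m\<close> again, so identities known only there may be used inside
  products.\<close>

lemma times_series_cong:
  assumes "\<alpha> \<in> multi_idx m"
    and "\<And>\<beta>. \<beta> \<in> multi_idx m \<Longrightarrow> a \<beta> = a' \<beta>"
    and "\<And>\<beta>. \<beta> \<in> multi_idx m \<Longrightarrow> b \<beta> = b' \<beta>"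
  shows "times_series a b \<alpha> = times_series a' b' \<alpha>"
  unfolding times_series_def using assms by (intro sum.cong) auto

lemma times_series_scale_add_left:
  "times_series (\<lambda>\<beta>. x * a \<beta> + b \<beta>) c \<alpha> = x * times_series a c \<alpha> + times_series b c \<alpha>"
  by (simp add: times_series_def sum_distrib_left sum.distrib[symmetric] split_beta algebra_simps)

lemma times_series_scale_left: "times_series (\<lambda>\<beta>. x * a \<beta>) b \<alpha> = x * times_series a b \<alpha>"
  by (simp add: times_series_def sum_distrib_left split_beta algebra_simps)

lemma times_series_sum_right:
  "times_series a (\<lambda>\<beta>. \<Sum>p\<in>P. b p \<beta> * x p) \<alpha> = (\<Sum>p\<in>P. times_series a (b p) \<alpha> * x p)"
  unfolding times_series_def sum_distrib_right
  by (subst sum.swap) (simp add: split_beta sum_distrib_left algebra_simps)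

text \<open>The only split with a nonzero factor takes \<open>unit_idx k\<close> out of
  \<open>\<alpha>\<close>, and it exists exactly when the exponent of the variable is
  positive.\<close>

lemma times_series_var_pd:
  "times_series (var_series k) (pd k a) \<alpha> = of_nat (Poly_Mapping.lookup \<alpha> k) * a \<alpha>"
proof (cases "Poly_Mapping.lookup \<alpha> k = 0")
  case True
  have "var_series k \<beta> = 0" if "\<beta> + \<gamma> = \<alpha>" for \<beta> \<gamma>
    using True that by (auto simp: var_series_def lookup_add)
  then show ?thesis
    using True by (auto simp: times_series_def intro!: sum.neutral)
next
  case False
  then obtain \<gamma> where \<gamma>: "\<alpha> = \<gamma> + unit_idx k" using idx_remove_unit by blast
  then show ?thesis
    by (subst times_series_single[of "unit_idx k" \<gamma>]) (auto simp: var_series_def pd_def add.commute)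
qed

text \<open>In a split with both parts nonzero, each part has smaller degree than
  \<open>\<alpha>\<close>, so both products have the same term there. Only
  \<open>(\<alpha>, 0)\<close> and \<open>(0, \<alpha>)\<close> survive, and the difference becomes
  linear in the discrepancies at \<open>\<alpha>\<close>.\<close>

lemma times_series_diff:
  assumes "\<alpha> \<in> multi_idx m" "\<alpha> \<noteq> 0"
    and "\<And>\<beta>. \<beta> \<in> multi_idx m \<Longrightarrow> idx_deg \<beta> < idx_deg \<alpha> \<Longrightarrow> a \<beta> = a' \<beta>"
    and "\<And>\<beta>. \<beta> \<in> multi_idx m \<Longrightarrow> idx_deg \<beta> < idx_deg \<alpha> \<Longrightarrow> b \<beta> = b' \<beta>"
  shows "times_series a b \<alpha> - times_series a' b' \<alpha> = (a \<alpha> - a' \<alpha>) * b 0 + a 0 * (b \<alpha> - b' \<alpha>)"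
proof -
  have "times_series a b \<alpha> - times_series a' b' \<alpha>
      = (\<Sum>(\<beta>, \<gamma>) \<in> {(\<beta>, \<gamma>). \<beta> + \<gamma> = \<alpha>}. a \<beta> * b \<gamma> - a' \<beta> * b' \<gamma>)"
    by (simp add: times_series_def sum_subtractf split_beta)
  also have "\<dots> = (\<Sum>(\<beta>, \<gamma>) \<in> {(\<alpha>, 0), (0, \<alpha>)}. a \<beta> * b \<gamma> - a' \<beta> * b' \<gamma>)"
  proof (intro sum.mono_neutral_right finite_idx_splits ballI)
    show "{(\<alpha>, 0), (0, \<alpha>)} \<subseteq> {(\<beta>, \<gamma>). \<beta> + \<gamma> = \<alpha>}" by simp
    fix p assume p: "p \<in> {(\<beta>, \<gamma>). \<beta> + \<gamma> = \<alpha>} - {(\<alpha>, 0), (0, \<alpha>)}"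
    obtain \<beta> \<gamma> where p_eq: "p = (\<beta>, \<gamma>)" by (cases p)
    then have eq: "\<alpha> = \<beta> + \<gamma>" and "\<beta> \<noteq> 0" "\<gamma> \<noteq> 0" using p by auto
    then have "0 < idx_deg \<beta>" "0 < idx_deg \<gamma>" by (auto intro: idx_deg_pos)
    moreover have "\<beta> \<in> multi_idx m" "\<gamma> \<in> multi_idx m" using eq assms(1) by auto
    ultimately show "(case p of (\<beta>, \<gamma>) \<Rightarrow> a \<beta> * b \<gamma> - a' \<beta> * b' \<gamma>) = 0"
      using assms(3)[of \<beta>] assms(4)[of \<gamma>] eq p_eq by (simp add: idx_deg_add[of _ m])
  qed
  \<comment> \<open>\<open>\<alpha> \<noteq> 0\<close> makes the two splits distinct and puts
    exponent \<open>0\<close> among those of smaller degree, where the series agree.\<close>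
  also have "\<dots> = (a \<alpha> - a' \<alpha>) * b 0 + a 0 * (b \<alpha> - b' \<alpha>)"
    using assms(2) assms(3)[of 0] assms(4)[of 0] idx_deg_pos[OF assms(2)]
    by (simp add: algebra_simps)
  finally show ?thesis .
qed

lemma times_series_zero: "times_series a b 0 = a 0 * b 0"
proof (rule times_series_single)
  fix \<beta> \<gamma> :: "nat \<Rightarrow>\<^sub>0 nat"
  assume eq: "\<beta> + \<gamma> = 0" and "\<beta> \<noteq> 0"
  have "Poly_Mapping.lookup \<beta> i = 0" for i
    using arg_cong[OF eq, of "\<lambda>\<alpha>. Poly_Mapping.lookup \<alpha> i"] by (simp add: lookup_add)
  then have "\<beta> = 0" by (intro poly_mapping_eqI) simp
  then show "a \<beta> * b \<gamma> = 0" using \<open>\<beta> \<noteq> 0\<close> by simp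
qed simp

section \<open>Third partial derivatives\<close>

lemma pd_commute: "pd i (pd j a) = pd j (pd i a)"
  by (rule ext) (auto simp: pd_def add_ac)

lemma pd3_swap12: "pd3 i j k a = pd3 j i k a"
  by (simp add: pd3_def pd_commute[of i j])

lemma pd3_swap23: "pd3 i j k a = pd3 i k j a"
  by (simp add: pd3_def pd_commute[of j k])

lemma pd3_rotate: "pd3 i j k a = pd3 j k i a"
  by (metis pd3_swap12 pd3_swap23)

text \<open>The quotient of the factorials of
  \<open>\<beta> + unit_idx i + unit_idx j + unit_idx k\<close> and \<open>\<beta>\<close>. Being
  nonzero and independent of the series, it cancels when two series are compared.\<close>

definition pd3_weight :: "nat \<Rightarrow> nat \<Rightarrow> nat \<Rightarrow> (nat \<Rightarrow>\<^sub>0 nat) \<Rightarrow> complex" where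
  "pd3_weight i j k \<beta> = of_nat ((Poly_Mapping.lookup \<beta> i + 1)
     * (Poly_Mapping.lookup (\<beta> + unit_idx i) j + 1)
     * (Poly_Mapping.lookup (\<beta> + unit_idx i + unit_idx j) k + 1))"

lemma pd3_eq: "pd3 i j k a \<beta> = pd3_weight i j k \<beta> * a (\<beta> + unit_idx i + unit_idx j + unit_idx k)"
  by (simp add: pd3_def pd_def pd3_weight_def mult.assoc)

lemma pd3_weight_nonzero [simp]: "pd3_weight i j k \<beta> \<noteq> 0"
  unfolding pd3_weight_def of_nat_eq_0_iff by simp


section \<open>Weights and spectrum\<close>

text \<open>A nonzero entry at \<open>k\<close> would be positive, so by sortedness all zeros would
  sit before \<open>k\<close>, and there could be at most \<open>k\<close> of them.\<close>

lemma sorted_nth_zero: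
  fixes xs :: "real list"
  assumes "\<And>x. x \<in> set xs \<Longrightarrow> 0 \<le> x" and "k < length (filter (\<lambda>x. x = 0) xs)"
  shows "sort xs ! k = 0"
proof (rule ccontr)
  let ?ys = "sort xs"
  assume neq: "?ys ! k \<noteq> 0"
  have "length (filter (\<lambda>x. x = 0) ?ys) = length (filter (\<lambda>x. x = 0) xs)"
    by (simp add: filter_sort)
  then have k: "k < length (filter (\<lambda>x. x = 0) ?ys)" using assms(2) by simp
  then have klen: "k < length ?ys" by (meson length_filter_le order_less_le_trans)
  then have pos: "0 < ?ys ! k" using assms(1) neq nth_mem[OF klen] by force
  have "{i. i < length ?ys \<and> ?ys ! i = 0} \<subseteq> {..<k}"
  proof safe
    fix i assume i: "i < length ?ys" "?ys ! i = 0"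
    show "i < k"
    proof (rule ccontr)
      assume "\<not> i < k"
      then have "?ys ! k \<le> ?ys ! i" using i by (intro sorted_nth_mono) auto
      then show False using i pos by simp
    qed
  qed
  then have "card {i. i < length ?ys \<and> ?ys ! i = 0} \<le> k"
    using card_mono[of "{..<k}"] by force
  then show False using k by (simp add: length_filter_conv_card)
qed

locale weights =
  fixes n :: nat and w :: "nat \<Rightarrow> nat"
  assumes n_pos: "1 \<le> n" and w_pos: "\<And>i. i \<le> n \<Longrightarrow> 1 \<le> w i"
begin

abbreviation "\<mu> \<equiv> mu n w"
abbreviation "dual \<equiv> dual_idx n w"
abbreviation "succ j \<equiv> (j + 1) mod \<mu>"
abbreviation "c \<equiv> euler_coeff n w"
abbreviation "g \<equiv> metric n w"
abbreviation "h a \<equiv> inv_metric n w $$ (a, dual a)"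
abbreviation "\<epsilon> k \<equiv> (of_real (1 - sigma n w k) :: complex)"

lemma n_less: "n < \<mu>"
proof -
  have "(\<Sum>i\<le>n. 1) \<le> (\<Sum>i\<le>n. w i)" using w_pos by (intro sum_mono) auto
  then show ?thesis by (simp add: mu_def)
qed

lemma one_less: "1 < \<mu>"
  using n_less n_pos by simp

lemma dual_eq: "a < \<mu> \<Longrightarrow> dual a = (if a \<le> n then n - a else n + \<mu> - a)"
  using n_less by (auto simp: dual_idx_def mod_if)

lemma dual_less [simp]: "a < \<mu> \<Longrightarrow> dual a < \<mu>"
  using n_less by (simp add: dual_idx_def)

lemma dual_iff: "\<lbrakk>j < \<mu>; k < \<mu>\<rbrakk> \<Longrightarrow> (j + k) mod \<mu> = n \<longleftrightarrow> k = dual j"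
  using n_less by (auto simp: dual_eq mod_if)

lemma dual_dual [simp]: "a < \<mu> \<Longrightarrow> dual (dual a) = a"
  by (metis add.commute dual_iff dual_less)

lemma succ_less [simp]: "succ j < \<mu>"
  using one_less by simp

lemma sum_dual: "(\<Sum>a<\<mu>. f (dual a)) = (\<Sum>a<\<mu>. f a)"
  by (rule sum.reindex_bij_witness[of _ dual dual]) auto

lemma prod_inverse_weights_nonzero: "(\<Prod>i\<in>idx_I n w r. inverse (of_nat (w i))) \<noteq> (0 :: complex)"
  using w_pos by (force simp: idx_I_def)

lemma euler_coeff_nonzero [simp]: "c j \<noteq> 0"
  using prod_inverse_weights_nonzero by (simp add: euler_coeff_def)

lemma metric_zero: "\<lbrakk>j < \<mu>; k < \<mu>; k \<noteq> dual j\<rbrakk> \<Longrightarrow> g $$ (j, k) = 0"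
  by (simp add: metric_def dual_iff)

lemma metric_dual_nonzero: "j < \<mu> \<Longrightarrow> g $$ (j, dual j) \<noteq> 0"
  using prod_inverse_weights_nonzero by (simp add: metric_def dual_iff)

text \<open>The metric is antidiagonal modulo \<open>\<mu>\<close>: column \<open>k\<close> has its
  only nonzero entry in row \<open>dual k\<close>.\<close>

lemma sum_metric_left:
  assumes "k < \<mu>"
  shows "(\<Sum>a<\<mu>. f a * g $$ (a, k)) = f (dual k) * g $$ (dual k, k)"
proof -
  have "(\<Sum>a<\<mu>. f a * g $$ (a, k)) = (\<Sum>a\<in>{dual k}. f a * g $$ (a, k))"
    using assms by (intro sum.mono_neutral_right) (auto intro!: metric_zero)
  then show ?thesis by simp
qed

text \<open>Each of the \<open>n + 1\<close> lists contains the fraction with \<open>l = 0\<close>,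
  so at least \<open>n + 1\<close> zeros are sorted to the front. This fixes the constant in
  \<open>sigma_dual\<close>.\<close>

lemma spec_zero:
  assumes "k \<le> n"
  shows "spec n w k = 0"
proof -
  let ?f = "\<lambda>i. map (\<lambda>l. real l / real (w i)) [0..<w i]"
  have "1 \<le> length (filter (\<lambda>x. x = 0) (?f i))" if "i \<le> n" for i
    using w_pos[OF that] by (simp add: upt_conv_Cons)
  then have "m \<le> length (filter (\<lambda>x. x = 0) (concat (map ?f [0..<m])))" if "m \<le> Suc n" for m
    using that
  proof (induction m)
    case (Suc m)
    then have "m \<le> length (filter (\<lambda>x. x = 0) (concat (map ?f [0..<m])))"
      "1 \<le> length (filter (\<lambda>x. x = 0) (?f m))" by auto
    then show ?case by simp
  qed simp
  from this[of "Suc n"] show ?thesis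
    unfolding spec_def using assms by (intro sorted_nth_zero) auto
qed

text \<open>The linear part of the field multiplies a coefficient by the weighted degree of its
  exponent. The constant term contributes the derivative along \<open>t_1\<close>, which links each
  coefficient to one of degree one higher.\<close>

lemma vf_deriv_euler:
  "vf_deriv \<mu> (euler_field n w) a \<alpha>
     = (\<Sum>k<\<mu>. \<epsilon> k * of_nat (Poly_Mapping.lookup \<alpha> k)) * a \<alpha> + of_nat \<mu> * pd 1 a \<alpha>"
proof -
  have "times_series (euler_field n w k) (pd k a) \<alpha>
      = \<epsilon> k * of_nat (Poly_Mapping.lookup \<alpha> k) * a \<alpha> + (if k = 1 then of_nat \<mu> * pd 1 a \<alpha> else 0)"
    for k
    by (simp add: euler_field_def times_series_scale_add_left times_series_var_pd)
  then show ?thesis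
    using one_less by (simp add: vf_deriv_def sum.distrib sum_distrib_right)
qed

lemma pd_euler_field:
  "pd a (euler_field n w k) \<alpha> = const_series (if a = k then \<epsilon> k else 0) \<alpha>"
proof -
  have "\<alpha> + unit_idx a = unit_idx k \<longleftrightarrow> \<alpha> = 0 \<and> a = k"
  proof safe
    assume eq: "\<alpha> + unit_idx a = unit_idx k"
    have l: "Poly_Mapping.lookup \<alpha> i + (if a = i then 1 else 0) = (if k = i then 1 else 0)" for i
      using arg_cong[OF eq, of "\<lambda>\<alpha>. Poly_Mapping.lookup \<alpha> i"]
      by (simp add: lookup_single when_def)
    show "a = k" using l[of a] by (auto split: if_splits)
    then have "Poly_Mapping.lookup \<alpha> i = 0" for i using l[of i] by (auto split: if_splits)
    then show "\<alpha> = 0" by (intro poly_mapping_eqI) simp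
  qed simp
  then show ?thesis by (auto simp: pd_def euler_field_def var_series_def const_series_def)
qed

end


section \<open>The potential of the canonical Frobenius structure\<close>

locale canonical_potential = weights +
  fixes M :: "nat \<Rightarrow> nat \<Rightarrow> nat \<Rightarrow> series" and F :: series
  assumes canonical: "canonical_frobenius n w M"
    and potential: "is_potential \<mu> g M F"
begin

sublocale frobenius_germ \<mu> g M unit_field "euler_field n w"
  using canonical by (simp add: canonical_frobenius_def)

lemma metric_commute:
  assumes "j < \<mu>" "k < \<mu>"
  shows "g $$ (j, k) = g $$ (k, j)"
proof -
  have "transpose_mat g $$ (j, k) = g $$ (k, j)" using assms metric_carrier by auto
  then show ?thesis by (simp add: metric_sym)
qed

text \<open>In the diagonal entry \<open>(a, a)\<close> of inverse times metric, the antidiagonal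
  shape leaves one product.\<close>

lemma inv_metric_dual:
  assumes "a < \<mu>"
  shows "h a * g $$ (dual a, a) = 1"
proof -
  \<comment> \<open>Since \<open>inv_metric\<close> is defined through \<open>the\<close>,
    \<open>mat_inverse\<close> must be shown to succeed; its criterion is membership in the units of
    the matrix ring.\<close>
  have "g \<in> Units (ring_mat TYPE(complex) \<mu> ())"
  proof -
    obtain B where B: "inverts_mat g B" "inverts_mat B g"
      using metric_nondegenerate by (auto simp: invertible_mat_def)
    then have eqs: "g * B = 1\<^sub>m \<mu>" "B * g = 1\<^sub>m (dim_row B)"
      using metric_carrier by (auto simp: inverts_mat_def)
    \<comment> \<open>\<open>invertible_mat\<close> does not record the size of \<open>B\<close>; it
      is read off from the two product equations.\<close>
    have "dim_col B = \<mu>" "dim_row B = \<mu>"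
      using arg_cong[OF eqs(1), of dim_col] arg_cong[OF eqs(2), of dim_col] metric_carrier by auto
    then have "B \<in> carrier_mat \<mu> \<mu>" by auto
    then show ?thesis
      using eqs metric_carrier by (auto simp: Units_def ring_mat_def)
  qed
  then obtain B where "mat_inverse g = Some B"
    using mat_inverse(1)[OF metric_carrier, of "()"] by (cases "mat_inverse g") auto
  then have B: "inv_metric n w * g = 1\<^sub>m \<mu>" "inv_metric n w \<in> carrier_mat \<mu> \<mu>"
    using mat_inverse(2)[OF metric_carrier] by (auto simp: inv_metric_def)
  have "1 = (inv_metric n w * g) $$ (a, a)" using B assms by simp
  also have "\<dots> = (\<Sum>b<\<mu>. inv_metric n w $$ (a, b) * g $$ (b, a))"
    using B(2) metric_carrier assms by (simp add: scalar_prod_def lessThan_atLeast0)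
  also have "\<dots> = h a * g $$ (dual a, a)" using assms by (rule sum_metric_left)
  finally show ?thesis by simp
qed

section \<open>WDVV from associativity\<close>

lemma pd3_potential:
  assumes "i < \<mu>" "j < \<mu>" "k < \<mu>" "\<alpha> \<in> multi_idx \<mu>"
  shows "pd3 i j k F \<alpha> = (\<Sum>a<\<mu>. M i j a \<alpha> * g $$ (a, k))"
  using potential assms by (auto simp: is_potential_def)

text \<open>The inverse metric raises the last index again and gives back a structure
  series.\<close>

lemma pd3_potential_dual:
  assumes "i < \<mu>" "j < \<mu>" "a < \<mu>" "\<alpha> \<in> multi_idx \<mu>"
  shows "h a * pd3 i j a F \<alpha> = M i j (dual a) \<alpha>"
  using assms inv_metric_dual[of a] by (simp add: pd3_potential sum_metric_left algebra_simps)

text \<open>Raising the index \<open>a\<close> turns the contraction into a composed product: the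
  sum is the pairing of \<open>(e_i \<star> e_j) \<star> e_k\<close> with
  \<open>e_l\<close>.\<close>

lemma WDVV_side:
  assumes "i < \<mu>" "j < \<mu>" "k < \<mu>" "l < \<mu>" "\<alpha> \<in> multi_idx \<mu>"
  shows "(\<Sum>a<\<mu>. h a * times_series (pd3 i j a F) (pd3 (dual a) k l F) \<alpha>)
     = (\<Sum>p<\<mu>. (\<Sum>b<\<mu>. times_series (M i j b) (M b k p) \<alpha>) * g $$ (p, l))"
proof -
  have "(\<Sum>a<\<mu>. h a * times_series (pd3 i j a F) (pd3 (dual a) k l F) \<alpha>)
      = (\<Sum>a<\<mu>. times_series (M i j (dual a)) (pd3 (dual a) k l F) \<alpha>)"
    using assms
    by (intro sum.cong refl, subst times_series_scale_left[symmetric])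
      (auto intro!: times_series_cong[of _ \<mu>] simp: pd3_potential_dual)
  also have "\<dots> = (\<Sum>b<\<mu>. times_series (M i j b) (pd3 b k l F) \<alpha>)"
    by (rule sum_dual)
  also have "\<dots> = (\<Sum>b<\<mu>. times_series (M i j b) (\<lambda>\<beta>. \<Sum>p<\<mu>. M b k p \<beta> * g $$ (p, l)) \<alpha>)"
    using assms by (intro sum.cong refl times_series_cong[of _ \<mu>]) (auto simp: pd3_potential)
  also have "\<dots> = (\<Sum>p<\<mu>. (\<Sum>b<\<mu>. times_series (M i j b) (M b k p) \<alpha>) * g $$ (p, l))"
    by (simp add: times_series_sum_right sum_distrib_right) (rule sum.swap)
  finally show ?thesis .
qed

text \<open>By \<open>WDVV_side\<close> the two sides pair
  \<open>(e_i \<star> e_j) \<star> e_k\<close> and \<open>(e_j \<star> e_k) \<star> e_i\<close> with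
  \<open>e_l\<close>; associativity and commutativity identify these products.\<close>

lemma WDVV_potential: "WDVV n w F"
  unfolding WDVV_def
proof (intro allI impI ballI)
  fix i j k l \<alpha>
  assume less: "i < \<mu>" "j < \<mu>" "k < \<mu>" "l < \<mu>" and \<alpha>: "\<alpha> \<in> multi_idx \<mu>"
  have "(\<Sum>b<\<mu>. times_series (M i j b) (M b k p) \<alpha>) = (\<Sum>b<\<mu>. times_series (M j k b) (M b i p) \<alpha>)"
    if "p < \<mu>" for p
  proof -
    have "(\<Sum>b<\<mu>. times_series (M i j b) (M b k p) \<alpha>) = (\<Sum>b<\<mu>. times_series (M j k b) (M i b p) \<alpha>)"
      using less(1,2,3) that \<alpha> by (rule mult_assoc)
    also have "\<dots> = (\<Sum>b<\<mu>. times_series (M j k b) (M b i p) \<alpha>)"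
      using less that \<alpha> by (intro sum.cong refl times_series_cong[of _ \<mu>]) (auto intro: mult_comm)
    finally show ?thesis .
  qed
  then show "(\<Sum>a<\<mu>. h a * times_series (pd3 i j a F) (pd3 (dual a) k l F) \<alpha>)
      = (\<Sum>a<\<mu>. h a * times_series (pd3 j k a F) (pd3 (dual a) i l F) \<alpha>)"
    using less \<alpha> by (simp add: WDVV_side)
qed

section \<open>Homogeneity from the Euler field\<close>

text \<open>Entry \<open>(j, dual j)\<close> of the Lie derivative condition on the metric makes
  \<open>\<epsilon> j + \<epsilon> (dual j)\<close> the same constant for all
  \<open>j\<close>.\<close>

lemma sigma_dual:
  assumes "k < \<mu>"
  shows "\<epsilon> k + \<epsilon> (dual k) = 2 - of_nat n"
proof -
  obtain D :: complex where D: "\<And>j k \<alpha>. \<lbrakk>j < \<mu>; k < \<mu>; \<alpha> \<in> multi_idx \<mu>\<rbrakk> \<Longrightarrow>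
     (\<Sum>a<\<mu>. pd j (euler_field n w a) \<alpha> * g $$ (a, k))
       + (\<Sum>a<\<mu>. pd k (euler_field n w a) \<alpha> * g $$ (j, a)) = const_series (D * g $$ (j, k)) \<alpha>"
    using euler_metric by blast
  have eq: "\<epsilon> j + \<epsilon> (dual j) = D" if j: "j < \<mu>" for j
  proof -
    have "(\<Sum>a<\<mu>. pd j (euler_field n w a) 0 * g $$ (a, dual j)) = \<epsilon> j * g $$ (j, dual j)"
      using j by (simp add: pd_euler_field const_series_def if_distrib[of "\<lambda>x. x * _"] cong: if_cong)
    moreover have "(\<Sum>a<\<mu>. pd (dual j) (euler_field n w a) 0 * g $$ (j, a))
        = \<epsilon> (dual j) * g $$ (j, dual j)"
      using j by (simp add: pd_euler_field const_series_def if_distrib[of "\<lambda>x. x * _"] cong: if_cong)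
    ultimately have "(\<epsilon> j + \<epsilon> (dual j)) * g $$ (j, dual j) = D * g $$ (j, dual j)"
      using D[of j "dual j" 0] j by (simp only: const_series_def distrib_right dual_less) simp
    then show ?thesis using metric_dual_nonzero[OF j] by simp
  qed
  \<comment> \<open>The pair \<open>0\<close>, \<open>n\<close> identifies the constant: the
    spectrum vanishes at both, so \<open>\<epsilon> 0 = 1\<close> and
    \<open>\<epsilon> n = 1 - n\<close>.\<close>
  have "0 < \<mu>" using n_less by simp
  then have "dual 0 = n" by (simp add: dual_eq)
  then have "D = 2 - of_nat n"
    using eq[OF \<open>0 < \<mu>\<close>] by (simp add: sigma_def spec_zero)
  then show ?thesis using eq assms by simp
qed

text \<open>The derivatives of the Euler field are constant and diagonal, so each correction term in
  \<open>euler_mult\<close> collapses to a multiple of \<open>M i j k\<close>.\<close>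

lemma euler_mult_component:
  assumes "i < \<mu>" "j < \<mu>" "k < \<mu>" "\<beta> \<in> multi_idx \<mu>"
  shows "vf_deriv \<mu> (euler_field n w) (M i j k) \<beta> = (1 - \<epsilon> i - \<epsilon> j + \<epsilon> k) * M i j k \<beta>"
proof -
  have pd_eq: "pd a (euler_field n w b) = const_series (if a = b then \<epsilon> b else 0)" for a b
    by (rule ext) (rule pd_euler_field)
  have "vf_deriv \<mu> (euler_field n w) (M i j k) \<beta>
      - M i j k \<beta> * \<epsilon> k + \<epsilon> i * M i j k \<beta> + \<epsilon> j * M i j k \<beta> = M i j k \<beta>"
    using euler_mult[OF assms] assms
    by (simp add: pd_eq if_distrib[of "\<lambda>x. x * _"] if_distrib[of "\<lambda>x. _ * x"] cong: if_cong)
  then show ?thesis by (simp add: algebra_simps)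
qed

text \<open>Lowering an index is multiplication by one constant metric entry;
  \<open>sigma_dual\<close> converts the weight of the raised index \<open>dual l\<close> into that
  of \<open>l\<close>.\<close>

lemma vf_deriv_pd3:
  assumes "i < \<mu>" "j < \<mu>" "l < \<mu>" "\<beta> \<in> multi_idx \<mu>"
  shows "vf_deriv \<mu> (euler_field n w) (pd3 i j l F) \<beta>
    = (3 - of_nat n - \<epsilon> i - \<epsilon> j - \<epsilon> l) * pd3 i j l F \<beta>"
proof -
  have "vf_deriv \<mu> (euler_field n w) (pd3 i j l F) \<beta>
      = vf_deriv \<mu> (euler_field n w) (M i j (dual l)) \<beta> * g $$ (dual l, l)"
    using assms one_less
    by (simp add: vf_deriv_euler pd_def[of 1] pd3_potential sum_metric_left distrib_right mult.assoc)
  also have "\<dots> = (1 - \<epsilon> i - \<epsilon> j + \<epsilon> (dual l)) * pd3 i j l F \<beta>"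
    using assms by (simp add: euler_mult_component pd3_potential sum_metric_left)
  also have "\<epsilon> (dual l) = 2 - of_nat n - \<epsilon> l"
    using sigma_dual[OF assms(3)] by (simp add: algebra_simps)
  finally show ?thesis by (simp add: algebra_simps)
qed

text \<open>Differentiating along \<open>t_i\<close> lowers the weighted degree by
  \<open>\<epsilon> i\<close>, so the weights of the third derivatives add up to the weight of the
  potential in degree at least 3.\<close>

lemma homogeneous_potential: "homogeneous n w F"
  unfolding homogeneous_def
proof (intro ballI impI)
  fix \<alpha> assume "\<alpha> \<in> multi_idx \<mu>" "3 \<le> idx_deg \<alpha>"
  then obtain \<beta> i j l where \<alpha>: "\<alpha> = \<beta> + unit_idx i + unit_idx j + unit_idx l"
    and less: "i < \<mu>" "j < \<mu>" "l < \<mu>" and \<beta>: "\<beta> \<in> multi_idx \<mu>"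
    by (rule idx_deg_ge_3E)
  let ?S = "\<lambda>\<alpha>. \<Sum>k<\<mu>. \<epsilon> k * of_nat (Poly_Mapping.lookup \<alpha> k)"
  have S: "?S (\<gamma> + unit_idx k) = ?S \<gamma> + \<epsilon> k" if "k < \<mu>" for \<gamma> k
    using that
    by (simp add: distrib_left sum.distrib if_distrib[of of_nat] if_distrib[of "\<lambda>x. _ * x"]
        cong: if_cong)
  \<comment> \<open>After this exchange all terms carry the same nonzero factor
    \<open>pd3_weight i j l \<beta>\<close>, which cancels.\<close>
  have "pd 1 (pd3 i j l F) = pd3 i j l (pd 1 F)"
    by (simp add: pd3_def pd_commute[of 1])
  then have "pd3_weight i j l \<beta> * (?S \<beta> * F \<alpha> + of_nat \<mu> * pd 1 F \<alpha>)
      = pd3_weight i j l \<beta> * ((3 - of_nat n - \<epsilon> i - \<epsilon> j - \<epsilon> l) * F \<alpha>)"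
    using vf_deriv_pd3[OF less \<beta>]
    by (simp only: vf_deriv_euler pd3_eq \<alpha>[symmetric] distrib_left mult.left_commute)
  then have eq: "?S \<beta> * F \<alpha> + of_nat \<mu> * pd 1 F \<alpha> = (3 - of_nat n - \<epsilon> i - \<epsilon> j - \<epsilon> l) * F \<alpha>"
    by simp
  have "?S \<alpha> = ?S \<beta> + \<epsilon> i + \<epsilon> j + \<epsilon> l" unfolding \<alpha> using less by (simp only: S)
  then have "?S \<alpha> * F \<alpha> + of_nat \<mu> * pd 1 F \<alpha>
      = (?S \<beta> * F \<alpha> + of_nat \<mu> * pd 1 F \<alpha>) + (\<epsilon> i + \<epsilon> j + \<epsilon> l) * F \<alpha>"
    by (simp only: distrib_right add_ac)
  also have "\<dots> = (3 - of_nat n) * F \<alpha>"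
    unfolding eq by (simp add: algebra_simps)
  finally show "vf_deriv \<mu> (euler_field n w) F \<alpha> = (3 - of_nat n) * F \<alpha>"
    by (simp only: vf_deriv_euler)
qed

section \<open>Multiplication by \<open>e_1\<close> at the origin\<close>

text \<open>The linear terms of the Euler field vanish at the origin, where it equals
  \<open>\<mu>\<close> times \<open>e_1\<close>; dividing its prescribed multiplication by
  \<open>\<mu>\<close> gives that of \<open>e_1\<close>.\<close>

lemma mult_one_zero:
  assumes "j < \<mu>" "k < \<mu>"
  shows "M 1 j k 0 = (if k = succ j then c j else 0)"
proof -
  have "euler_field n w i 0 = (if i = 1 then of_nat \<mu> else 0)" for i
    using unit_idx_nonzero[of i] by (auto simp: euler_field_def var_series_def const_series_def)
  then have "(\<Sum>i<\<mu>. euler_field n w i 0 * M i j k 0) = of_nat \<mu> * M 1 j k 0"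
    using one_less by (simp add: if_distrib[of "\<lambda>x. x * _"] cong: if_cong)
  moreover have "(\<Sum>i<\<mu>. euler_field n w i 0 * M i j k 0)
      = (if k = succ j then of_nat \<mu> * c j else 0)"
    using canonical assms by (auto simp: canonical_frobenius_def)
  ultimately show ?thesis using one_less by (auto split: if_splits)
qed

lemma pd3_one_zero:
  assumes "j < \<mu>" "k < \<mu>"
  shows "pd3 1 j k F 0 = c j * g $$ (succ j, k)"
  using assms one_less
  by (simp add: pd3_potential mult_one_zero if_distrib[of "\<lambda>x. x * _"] cong: if_cong)

lemma pd3_one_zero_eq_zero:
  assumes "j < \<mu>" "k < \<mu>" "(1 + j + k) mod \<mu> \<noteq> n"
  shows "pd3 1 j k F 0 = 0"
proof -
  have "(succ j + k) mod \<mu> \<noteq> n" using assms(3) by (simp add: mod_add_left_eq add_ac[of _ 1])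
  then have "k \<noteq> dual (succ j)" using assms by (simp add: dual_iff[symmetric])
  then show ?thesis using assms by (simp add: pd3_one_zero metric_zero)
qed


subsection \<open>Reconstruction\<close>

text \<open>Raising the index \<open>a\<close> gives the components of
  \<open>e_1 \<star> e_j\<close>, a multiple of one basis vector, so only
  \<open>a = dual (succ j)\<close> contributes. \<open>D\<close> stands for a difference of two
  solutions with its other indices fixed.\<close>

lemma sum_pd3_one_left:
  assumes "j < \<mu>"
  shows "(\<Sum>a<\<mu>. h a * (pd3 1 j a F 0 * D (dual a))) = c j * D (succ j)"
proof -
  have "(\<Sum>a<\<mu>. h a * (pd3 1 j a F 0 * D (dual a)))
      = (\<Sum>a<\<mu>. (if a = dual (succ j) then c j * D (succ j) else 0))"
  proof (intro sum.cong refl)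
    fix a assume "a \<in> {..<\<mu>}"
    then show "h a * (pd3 1 j a F 0 * D (dual a)) = (if a = dual (succ j) then c j * D (succ j) else 0)"
      using inv_metric_dual[of a] assms metric_zero[of "succ j" a]
      by (auto simp: pd3_one_zero)
  qed
  then show ?thesis by simp
qed

text \<open>The factor \<open>pd3 (dual a) 1 l F 0\<close> pairs \<open>e_1 \<star> e_l\<close> with
  the basis vector of index \<open>dual a\<close>, so only \<open>a = succ l\<close>
  contributes.\<close>

lemma sum_pd3_one_right:
  assumes "l < \<mu>"
  shows "(\<Sum>a<\<mu>. h a * (D a * pd3 (dual a) 1 l F 0)) = c l * D (succ l)"
proof -
  have "(\<Sum>a<\<mu>. h a * (D a * pd3 (dual a) 1 l F 0))
      = (\<Sum>a<\<mu>. (if a = succ l then c l * D (succ l) else 0))"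
  proof (intro sum.cong refl)
    fix a assume a: "a \<in> {..<\<mu>}"
    then have "pd3 (dual a) 1 l F 0 = c l * g $$ (dual a, succ l)"
      using assms by (subst pd3_rotate) (simp add: pd3_one_zero metric_commute)
    then show "h a * (D a * pd3 (dual a) 1 l F 0) = (if a = succ l then c l * D (succ l) else 0)"
      using inv_metric_dual[of a] a metric_zero[of "dual a" "succ l"] by auto
  qed
  then show ?thesis by simp
qed

text \<open>The index \<open>0\<close> is reached as \<open>\<mu>\<close> modulo \<open>\<mu>\<close>, which replaces an argument with the unit.\<close>

lemma shift_relation_zero:
  fixes D :: "nat \<Rightarrow> nat \<Rightarrow> nat \<Rightarrow> complex"
  assumes shift: "\<And>j k l. \<lbrakk>j < \<mu>; k < \<mu>; l < \<mu>\<rbrakk> \<Longrightarrow> c j * D (succ j) k l = c l * D j k (succ l)"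
    and one: "\<And>k l. \<lbrakk>k < \<mu>; l < \<mu>\<rbrakk> \<Longrightarrow> D 1 k l = 0"
    and "j < \<mu>" "k < \<mu>" "l < \<mu>"
  shows "D j k l = 0"
proof -
  \<comment> \<open>\<open>l\<close> stays general in the induction, since each step lowers the
    first index at the cost of raising the last.\<close>
  have *: "D ((j + 1) mod \<mu>) k l = 0" if "l < \<mu>" for j l
    using that
  proof (induction j arbitrary: l)
    case 0
    then show ?case using one_less one assms(4) by simp
  next
    case (Suc j)
    have "c (succ j) * D (succ (succ j)) k l = c l * D (succ j) k (succ l)"
      using Suc.prems assms(4) by (intro shift) auto
    also have "\<dots> = 0" using Suc.IH[of "succ l"] by simp
    finally have "D (succ (succ j)) k l = 0" by simp
    then show ?case by (simp add: mod_add_left_eq Suc_eq_plus1)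
  qed
  show ?thesis
  proof (cases j)
    case 0
    then show ?thesis using *[of l "\<mu> - 1"] assms(5) one_less by simp
  next
    case (Suc i)
    then show ?thesis using *[of l i] assms(3,5) by (simp add: Suc_eq_plus1)
  qed
qed

section \<open>Comparison with a second solution\<close>

context
  fixes G :: series
  assumes WDVV_G: "WDVV n w G" and hom_G: "homogeneous n w G"
    and one_G: "\<And>j k. \<lbrakk>j < \<mu>; k < \<mu>\<rbrakk> \<Longrightarrow> pd3 1 j k G 0 = pd3 1 j k F 0"
begin

lemma WDVV_diff:
  assumes "i < \<mu>" "j < \<mu>" "k < \<mu>" "l < \<mu>" "\<beta> \<in> multi_idx \<mu>"
  shows "(\<Sum>a<\<mu>. h a * (times_series (pd3 i j a F) (pd3 (dual a) k l F) \<beta>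
        - times_series (pd3 i j a G) (pd3 (dual a) k l G) \<beta>))
    = (\<Sum>a<\<mu>. h a * (times_series (pd3 j k a F) (pd3 (dual a) i l F) \<beta>
        - times_series (pd3 j k a G) (pd3 (dual a) i l G) \<beta>))"
proof -
  have "(\<Sum>a<\<mu>. h a * times_series (pd3 i j a H) (pd3 (dual a) k l H) \<beta>)
      = (\<Sum>a<\<mu>. h a * times_series (pd3 j k a H) (pd3 (dual a) i l H) \<beta>)" if "WDVV n w H" for H
    using that assms unfolding WDVV_def by blast
  from this[OF WDVV_potential] this[OF WDVV_G] show ?thesis
    by (simp add: right_diff_distrib sum_subtractf)
qed

text \<open>At exponent \<open>0\<close> WDVV is quadratic in the constant terms, but with first
  index \<open>1\<close> every product has a factor that both solutions share by
  \<open>one_G\<close>. Subtraction therefore gives a linear relation for \<open>D\<close>, the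
  shift relation.\<close>

lemma pd3_zero_unique:
  assumes "j < \<mu>" "k < \<mu>" "l < \<mu>"
  shows "pd3 j k l F 0 = pd3 j k l G 0"
proof -
  define D where "D j k l = pd3 j k l F 0 - pd3 j k l G 0" for j k l
  have "D j k l = 0"
  proof (rule shift_relation_zero[OF _ _ assms])
    fix j k l assume less: "j < \<mu>" "k < \<mu>" "l < \<mu>"
    have "(\<Sum>a<\<mu>. h a * (pd3 1 j a F 0 * D (dual a) k l))
        = (\<Sum>a<\<mu>. h a * (D j k a * pd3 (dual a) 1 l F 0))"
      using WDVV_diff[OF one_less less(1,2,3), of 0] less one_less
      by (simp add: times_series_zero D_def one_G right_diff_distrib left_diff_distrib
          pd3_rotate[of _ 1 _])
    then show "c j * D (succ j) k l = c l * D j k (succ l)"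
      using less by (simp add: sum_pd3_one_left[where D = "\<lambda>a. D a k l"] sum_pd3_one_right)
  qed (simp add: D_def one_G)
  then show ?thesis by (simp add: D_def)
qed

text \<open>Induction step over the degree: \<open>times_series_diff\<close> leaves two terms per
  product, each with one factor \<open>D\<close>. Those in which \<open>D\<close> carries the index
  \<open>1\<close> vanish by homogeneity, and the others form the shift relation.\<close>

lemma potential_unique_induct:
  assumes "\<And>i j k \<gamma>. \<lbrakk>i < \<mu>; j < \<mu>; k < \<mu>; \<gamma> \<in> multi_idx \<mu>; idx_deg \<gamma> < idx_deg \<beta>\<rbrakk>
      \<Longrightarrow> pd3 i j k F \<gamma> = pd3 i j k G \<gamma>"
    and \<beta>: "\<beta> \<in> multi_idx \<mu>" "\<beta> \<noteq> 0"
    and less: "j < \<mu>" "k < \<mu>" "l < \<mu>"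
  shows "pd3 j k l F \<beta> = pd3 j k l G \<beta>"
proof -
  define D where "D j k l = pd3 j k l F \<beta> - pd3 j k l G \<beta>" for j k l
  have D_one: "D 1 k l = 0" if less: "k < \<mu>" "l < \<mu>" for k l
  proof -
    \<comment> \<open>\<open>\<beta> \<noteq> 0\<close> provides the third unit vector:
      \<open>?\<alpha>\<close> still has degree at least 3, and its coefficient belongs to a third
      derivative at \<open>\<gamma>\<close>, which has smaller degree than
      \<open>\<beta>\<close>.\<close>
    obtain d where "idx_deg \<beta> = Suc d" using idx_deg_pos[OF \<beta>(2)] gr0_implies_Suc by blast
    then obtain \<gamma> i where \<gamma>: "\<beta> = \<gamma> + unit_idx i" "i < \<mu>" "\<gamma> \<in> multi_idx \<mu>" "idx_deg \<gamma> = d"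
      using idx_deg_SucE[OF \<beta>(1)] by metis
    let ?\<alpha> = "\<gamma> + unit_idx i + unit_idx k + unit_idx l"
    have \<alpha>: "?\<alpha> \<in> multi_idx \<mu>" "3 \<le> idx_deg ?\<alpha>"
      using \<gamma> less by (simp_all add: idx_deg_add[of _ \<mu>])
    have eq: "F ?\<alpha> = G ?\<alpha>"
      using assms(1)[of i k l \<gamma>] \<gamma> less by (simp add: pd3_eq idx_deg_add[of _ \<mu>])
    have "vf_deriv \<mu> (euler_field n w) F ?\<alpha> = vf_deriv \<mu> (euler_field n w) G ?\<alpha>"
      using homogeneous_potential hom_G \<alpha> eq by (simp add: homogeneous_def)
    \<comment> \<open>The weighted-degree terms cancel since \<open>F\<close> and \<open>G\<close>
      agree at \<open>?\<alpha>\<close>, and the remaining factor \<open>\<mu>\<close> is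
      nonzero.\<close>
    then have "pd 1 F ?\<alpha> = pd 1 G ?\<alpha>"
      using eq one_less by (simp add: vf_deriv_euler)
    then have "F (?\<alpha> + unit_idx 1) = G (?\<alpha> + unit_idx 1)"
      by (simp add: pd_def of_nat_Suc[symmetric] del: of_nat_Suc of_nat_add)
    moreover have "?\<alpha> + unit_idx 1 = \<beta> + unit_idx 1 + unit_idx k + unit_idx l"
      using \<gamma>(1) by (simp add: add_ac)
    ultimately show ?thesis by (simp add: D_def pd3_eq)
  qed
  have "D j k l = 0"
  proof (rule shift_relation_zero[OF _ _ less])
    fix j k l assume less: "j < \<mu>" "k < \<mu>" "l < \<mu>"
    have diff: "times_series (pd3 i j a F) (pd3 b k l F) \<beta> - times_series (pd3 i j a G) (pd3 b k l G) \<beta>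
        = D i j a * pd3 b k l F 0 + pd3 i j a F 0 * D b k l"
      if "i < \<mu>" "j < \<mu>" "a < \<mu>" "b < \<mu>" "k < \<mu>" "l < \<mu>" for i j a b k l
      unfolding D_def using that assms(1) by (intro times_series_diff[OF \<beta>]) auto
    have D_one': "D a 1 l = 0" if "a < \<mu>" "l < \<mu>" for a l
      using D_one[OF that] by (simp add: D_def pd3_swap12[of a])
    have "(\<Sum>a<\<mu>. h a * (pd3 1 j a F 0 * D (dual a) k l))
        = (\<Sum>a<\<mu>. h a * (D j k a * pd3 (dual a) 1 l F 0))"
      using WDVV_diff[OF one_less less \<beta>(1)] less one_less
      by (simp add: diff D_one D_one')
    then show "c j * D (succ j) k l = c l * D j k (succ l)"
      using less by (simp add: sum_pd3_one_left[where D = "\<lambda>a. D a k l"] sum_pd3_one_right)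
  qed (rule D_one)
  then show ?thesis by (simp add: D_def)
qed

lemma pd3_unique:
  assumes "i < \<mu>" "j < \<mu>" "k < \<mu>" "\<beta> \<in> multi_idx \<mu>"
  shows "pd3 i j k F \<beta> = pd3 i j k G \<beta>"
  using assms
proof (induction "idx_deg \<beta>" arbitrary: \<beta> i j k rule: less_induct)
  case less
  then show ?case
    using pd3_zero_unique potential_unique_induct[of \<beta> i j k] by (cases "\<beta> = 0") auto
qed

lemma potential_unique:
  assumes "\<alpha> \<in> multi_idx \<mu>" "3 \<le> idx_deg \<alpha>"
  shows "F \<alpha> = G \<alpha>"
proof -
  obtain \<beta> i j k where "\<alpha> = \<beta> + unit_idx i + unit_idx j + unit_idx k"
    "i < \<mu>" "j < \<mu>" "k < \<mu>" "\<beta> \<in> multi_idx \<mu>"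
    using assms by (rule idx_deg_ge_3E)
  then show ?thesis using pd3_unique[of i j k \<beta>] by (simp add: pd3_eq)
qed

end

end

lemma idx_fact_nonzero [simp]: "idx_fact \<alpha> \<noteq> 0"
  by (simp add: idx_fact_def)

theorem theorem5p12:
  fixes n :: nat and w :: "nat \<Rightarrow> nat"
    and M :: "nat \<Rightarrow> nat \<Rightarrow> nat \<Rightarrow> series"
    and A :: "(nat \<Rightarrow>\<^sub>0 nat) \<Rightarrow> complex"
  assumes "n \<ge> 1"
    and "\<And>i. i \<le> n \<Longrightarrow> w i \<ge> 1"
    and "canonical_frobenius n w M"
    and "is_potential (mu n w) (metric n w) M (exp_series A)"
  shows "(\<forall>j<mu n w. \<forall>k<mu n w. (1 + j + k) mod mu n w \<noteq> n \<longrightarrow> coeff3 A 1 j k 0 = 0) \<and>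
    (\<forall>B :: (nat \<Rightarrow>\<^sub>0 nat) \<Rightarrow> complex.
       WDVV n w (exp_series B) \<and> homogeneous n w (exp_series B) \<and>
       (\<forall>j<mu n w. \<forall>k<mu n w. coeff3 B 1 j k 0 = coeff3 A 1 j k 0) \<longrightarrow>
       (\<forall>\<alpha>\<in>multi_idx (mu n w). 3 \<le> idx_deg \<alpha> \<longrightarrow> B \<alpha> = A \<alpha>))"
proof -
  interpret canonical_potential n w M "exp_series A"
    by unfold_locales (use assms in auto)
  \<comment> \<open>The factor is nonzero and does not depend on \<open>C\<close>, so zeros and
    equalities pass between \<open>coeff3\<close> and third derivatives at the origin.\<close>
  have exp_coeff3: "pd3 i j k (exp_series C) 0 = x * coeff3 C i j k 0"
    if "x = pd3_weight i j k 0 / of_nat (idx_fact (unit_idx i + unit_idx j + unit_idx k))" for C i j k x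
    using that by (simp add: pd3_eq exp_series_def coeff3_def)
  show ?thesis
  proof (intro conjI allI ballI impI; (elim conjE)?)
    fix j k assume "j < \<mu>" "k < \<mu>" "(1 + j + k) mod \<mu> \<noteq> n"
    then show "coeff3 A 1 j k 0 = 0"
      using pd3_one_zero_eq_zero exp_coeff3[OF refl, of 1 j k A] by simp
  next
    fix B \<alpha>
    assume "WDVV n w (exp_series B)" "homogeneous n w (exp_series B)"
      and "\<forall>j<\<mu>. \<forall>k<\<mu>. coeff3 B 1 j k 0 = coeff3 A 1 j k 0"
      and "\<alpha> \<in> multi_idx \<mu>" "3 \<le> idx_deg \<alpha>"
    then have "exp_series A \<alpha> = exp_series B \<alpha>"
      by (intro potential_unique) (simp_all add: exp_coeff3[OF refl])
    then show "B \<alpha> = A \<alpha>" by (simp add: exp_series_def)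
  qed
qed

end
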